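(* Work in ZF. Suppose \(\mathcal B\) is a filter base on a set \(X\) and \(\beta\) is an ordinal such that for every regular cardinal \(\gamma\le\beta\) there is a \(\gamma\)-descendingly closed fine filter on \(P(\mathcal B)\) concentrating on the set of \(\sigma\subseteq\mathcal B\) such that \(\bigcap\sigma\in\mathcal B\). Then the filter generated by \(\mathcal B\) is \(\beta\)-closed: for every sequence \(\langle A_\xi:\xi<\beta\rangle\) of members of it, \(\bigcap_{\xi<\beta}A_\xi\) belongs to it.
   Context: A filter base is a family of nonempty sets that is downward directed under inclusion; the filter it generates consists of all subsets of \(X\) containing some element of \(\mathcal B\). A filter on \(P(\mathcal B)\) is fine if for each \(A\in\mathcal B\), \(\{\sigma\subseteq\mathcal B: A\in\sigma\}\) is in it; it is \(\gamma\)-descendingly closed if the intersection of any decreasing \(\gamma\)-sequence of its members is in it; it concentrates on a set if that set belongs to it. *)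

theory Defs
  imports Main
begin

text \<open>
  The theorem is a theorem of ZF, whereas the logic of Isabelle/HOL includes choice.  It is
  therefore stated inside an arbitrary model of first-order ZF: a type of class \<open>ZF\<close> is a
  nonempty domain with a binary relation \<open>\<in>\<^sub>V\<close> satisfying the axioms of ZF.  Separation and
  Replacement have to be schemas over first-order formulas (with parameters); if they were
  stated for arbitrary HOL predicates, choice in HOL would make every model satisfy choice.

  All set-theoretic notions below are first-order over \<open>\<in>\<^sub>V\<close>: every quantifier ranges over
  elements of the model, so that sequences, filters, bijections etc. are elements of the model.
\<close>

subsection \<open>First-order formulas (de Bruijn indices)\<close>

datatype fm = Mem nat nat | Equal nat nat | Neg fm | Conj fm fm | Ex fm

primrec sat :: "('v \<Rightarrow> 'v \<Rightarrow> bool) \<Rightarrow> fm \<Rightarrow> (nat \<Rightarrow> 'v) \<Rightarrow> bool" where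
  "sat E (Mem i j) e \<longleftrightarrow> E (e i) (e j)"
| "sat E (Equal i j) e \<longleftrightarrow> e i = e j"
| "sat E (Neg p) e \<longleftrightarrow> \<not> sat E p e"
| "sat E (Conj p q) e \<longleftrightarrow> sat E p e \<and> sat E q e"
| "sat E (Ex p) e \<longleftrightarrow> (\<exists>x. sat E p (case_nat x e))"

subsection \<open>Models of ZF\<close>

class ZF =
  fixes mem :: "'a \<Rightarrow> 'a \<Rightarrow> bool"  (infix "\<in>\<^sub>V" 50)
  assumes extensionality: "(\<forall>x. x \<in>\<^sub>V a \<longleftrightarrow> x \<in>\<^sub>V b) \<Longrightarrow> a = b"
    and foundation: "(\<exists>x. x \<in>\<^sub>V a) \<Longrightarrow> \<exists>x. x \<in>\<^sub>V a \<and> \<not> (\<exists>y. y \<in>\<^sub>V x \<and> y \<in>\<^sub>V a)"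
    and pairing: "\<exists>c. \<forall>x. x \<in>\<^sub>V c \<longleftrightarrow> x = a \<or> x = b"
    and union: "\<exists>c. \<forall>x. x \<in>\<^sub>V c \<longleftrightarrow> (\<exists>y. y \<in>\<^sub>V a \<and> x \<in>\<^sub>V y)"
    and power: "\<exists>c. \<forall>x. x \<in>\<^sub>V c \<longleftrightarrow> (\<forall>y. y \<in>\<^sub>V x \<longrightarrow> y \<in>\<^sub>V a)"
    and infinity: "\<exists>w. (\<exists>z. z \<in>\<^sub>V w \<and> (\<forall>u. \<not> u \<in>\<^sub>V z)) \<and>
          (\<forall>x. x \<in>\<^sub>V w \<longrightarrow> (\<exists>y. y \<in>\<^sub>V w \<and> (\<forall>u. u \<in>\<^sub>V y \<longleftrightarrow> u \<in>\<^sub>V x \<or> u = x)))"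
    and separation: "\<exists>b. \<forall>x. x \<in>\<^sub>V b \<longleftrightarrow> x \<in>\<^sub>V a \<and> sat (\<in>\<^sub>V) p (case_nat x e)"
    and replacement:
      "(\<forall>x y z. x \<in>\<^sub>V a \<and> sat (\<in>\<^sub>V) p (case_nat x (case_nat y e)) \<and>
                 sat (\<in>\<^sub>V) p (case_nat x (case_nat z e)) \<longrightarrow> y = z) \<Longrightarrow>
       \<exists>b. \<forall>y. y \<in>\<^sub>V b \<longleftrightarrow> (\<exists>x. x \<in>\<^sub>V a \<and> sat (\<in>\<^sub>V) p (case_nat x (case_nat y e)))"

subsection \<open>Basic set theory\<close>

text \<open>
  \<open>vcollect P\<close> is the element of the model whose members are exactly the \<open>x\<close> with \<open>P x\<close>.  It is
  only meaningful if there is one.  In each use below existence follows from the axioms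
  (for \<open>vseqInter\<close>, provided that \<open>f\<close> is a function with domain \<open>\<gamma>\<close>).
\<close>

definition vcollect :: "('v::ZF \<Rightarrow> bool) \<Rightarrow> 'v" where
  "vcollect P = (THE a. \<forall>x. x \<in>\<^sub>V a \<longleftrightarrow> P x)"

definition vsubset :: "'v::ZF \<Rightarrow> 'v \<Rightarrow> bool"  (infix "\<subseteq>\<^sub>V" 50) where
  "a \<subseteq>\<^sub>V b \<longleftrightarrow> (\<forall>x. x \<in>\<^sub>V a \<longrightarrow> x \<in>\<^sub>V b)"

definition vnonempty :: "'v::ZF \<Rightarrow> bool" where
  "vnonempty a \<longleftrightarrow> (\<exists>x. x \<in>\<^sub>V a)"

definition vPow :: "'v::ZF \<Rightarrow> 'v" where
  "vPow a = vcollect (\<lambda>x. x \<subseteq>\<^sub>V a)"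

definition vint :: "'v::ZF \<Rightarrow> 'v \<Rightarrow> 'v"  (infixl "\<inter>\<^sub>V" 70) where
  "a \<inter>\<^sub>V b = vcollect (\<lambda>x. x \<in>\<^sub>V a \<and> x \<in>\<^sub>V b)"

text \<open>The intersection of a family of subsets of \<open>X\<close>; the empty family has intersection \<open>X\<close>.\<close>

definition vInter :: "'v::ZF \<Rightarrow> 'v \<Rightarrow> 'v" where
  "vInter X s = vcollect (\<lambda>x. x \<in>\<^sub>V X \<and> (\<forall>A. A \<in>\<^sub>V s \<longrightarrow> x \<in>\<^sub>V A))"

definition vupair :: "'v::ZF \<Rightarrow> 'v \<Rightarrow> 'v" where
  "vupair a b = vcollect (\<lambda>x. x = a \<or> x = b)"

definition vpair :: "'v::ZF \<Rightarrow> 'v \<Rightarrow> 'v" where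
  "vpair a b = vupair (vupair a a) (vupair a b)"

definition vfun :: "'v::ZF \<Rightarrow> 'v \<Rightarrow> 'v \<Rightarrow> bool" where
  "vfun f a b \<longleftrightarrow>
     (\<forall>p. p \<in>\<^sub>V f \<longrightarrow> (\<exists>x y. x \<in>\<^sub>V a \<and> y \<in>\<^sub>V b \<and> p = vpair x y)) \<and>
     (\<forall>x. x \<in>\<^sub>V a \<longrightarrow> (\<exists>!y. vpair x y \<in>\<^sub>V f))"

definition vapp :: "'v::ZF \<Rightarrow> 'v \<Rightarrow> 'v" where
  "vapp f x = (THE y. vpair x y \<in>\<^sub>V f)"

definition vbij :: "'v::ZF \<Rightarrow> 'v \<Rightarrow> 'v \<Rightarrow> bool" where
  "vbij f a b \<longleftrightarrow> vfun f a b \<and> (\<forall>y. y \<in>\<^sub>V b \<longrightarrow> (\<exists>!x. x \<in>\<^sub>V a \<and> vapp f x = y))"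

text \<open>The intersection, within \<open>X\<close>, of the sequence \<open>f\<close> of subsets of \<open>X\<close> of length \<open>\<gamma>\<close>.\<close>

definition vseqInter :: "'v::ZF \<Rightarrow> 'v \<Rightarrow> 'v \<Rightarrow> 'v" where
  "vseqInter X \<gamma> f = vcollect (\<lambda>x. x \<in>\<^sub>V X \<and> (\<forall>\<xi>. \<xi> \<in>\<^sub>V \<gamma> \<longrightarrow> x \<in>\<^sub>V vapp f \<xi>))"

subsection \<open>Ordinals and regular cardinals\<close>

text \<open>Transitive sets that are strictly well-ordered by membership.\<close>

definition vordinal :: "'v::ZF \<Rightarrow> bool" where
  "vordinal \<alpha> \<longleftrightarrow>
     (\<forall>x. x \<in>\<^sub>V \<alpha> \<longrightarrow> x \<subseteq>\<^sub>V \<alpha>) \<and>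
     (\<forall>x. x \<in>\<^sub>V \<alpha> \<longrightarrow> \<not> x \<in>\<^sub>V x) \<and>
     (\<forall>x y z. x \<in>\<^sub>V \<alpha> \<and> y \<in>\<^sub>V \<alpha> \<and> z \<in>\<^sub>V \<alpha> \<and> x \<in>\<^sub>V y \<and> y \<in>\<^sub>V z \<longrightarrow> x \<in>\<^sub>V z) \<and>
     (\<forall>x y. x \<in>\<^sub>V \<alpha> \<and> y \<in>\<^sub>V \<alpha> \<longrightarrow> x \<in>\<^sub>V y \<or> x = y \<or> y \<in>\<^sub>V x) \<and>
     (\<forall>s. s \<subseteq>\<^sub>V \<alpha> \<and> vnonempty s \<longrightarrow>
        (\<exists>x. x \<in>\<^sub>V s \<and> (\<forall>y. y \<in>\<^sub>V s \<longrightarrow> x = y \<or> x \<in>\<^sub>V y)))"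

definition vord_le :: "'v::ZF \<Rightarrow> 'v \<Rightarrow> bool"  (infix "\<le>\<^sub>V" 50) where
  "\<alpha> \<le>\<^sub>V \<beta> \<longleftrightarrow> \<alpha> \<in>\<^sub>V \<beta> \<or> \<alpha> = \<beta>"

definition vsucc_of :: "'v::ZF \<Rightarrow> 'v \<Rightarrow> bool" where
  "vsucc_of \<alpha> \<delta> \<longleftrightarrow> (\<forall>x. x \<in>\<^sub>V \<alpha> \<longleftrightarrow> x \<in>\<^sub>V \<delta> \<or> x = \<delta>)"

definition vfinite_ordinal :: "'v::ZF \<Rightarrow> bool" where
  "vfinite_ordinal n \<longleftrightarrow> vordinal n \<and>
     (\<forall>m. m \<le>\<^sub>V n \<longrightarrow> \<not> vnonempty m \<or> (\<exists>k. vsucc_of m k))"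

definition vinfinite_cardinal :: "'v::ZF \<Rightarrow> bool" where
  "vinfinite_cardinal \<kappa> \<longleftrightarrow> vordinal \<kappa> \<and> \<not> vfinite_ordinal \<kappa> \<and>
     \<not> (\<exists>\<delta> f. \<delta> \<in>\<^sub>V \<kappa> \<and> vbij f \<delta> \<kappa>)"

definition vcofinal_map :: "'v::ZF \<Rightarrow> 'v \<Rightarrow> 'v \<Rightarrow> bool" where
  "vcofinal_map f \<delta> \<alpha> \<longleftrightarrow> vfun f \<delta> \<alpha> \<and>
     (\<forall>\<eta>. \<eta> \<in>\<^sub>V \<alpha> \<longrightarrow> (\<exists>\<xi>. \<xi> \<in>\<^sub>V \<delta> \<and> \<eta> \<le>\<^sub>V vapp f \<xi>))"

definition vis_cofinality :: "'v::ZF \<Rightarrow> 'v \<Rightarrow> bool" where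
  "vis_cofinality \<kappa> \<alpha> \<longleftrightarrow> vordinal \<kappa> \<and> (\<exists>f. vcofinal_map f \<kappa> \<alpha>) \<and>
     \<not> (\<exists>\<delta> f. \<delta> \<in>\<^sub>V \<kappa> \<and> vcofinal_map f \<delta> \<alpha>)"

definition vregular_cardinal :: "'v::ZF \<Rightarrow> bool" where
  "vregular_cardinal \<kappa> \<longleftrightarrow> vinfinite_cardinal \<kappa> \<and> vis_cofinality \<kappa> \<kappa>"

subsection \<open>Filters\<close>

text \<open>As usual for directed families, a filter base is nonempty, and filters are proper.\<close>

definition vfilter_base :: "'v::ZF \<Rightarrow> 'v \<Rightarrow> bool" where
  "vfilter_base X B \<longleftrightarrow> B \<subseteq>\<^sub>V vPow X \<and> vnonempty B \<and>
     (\<forall>A. A \<in>\<^sub>V B \<longrightarrow> vnonempty A) \<and>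
     (\<forall>A C. A \<in>\<^sub>V B \<and> C \<in>\<^sub>V B \<longrightarrow> (\<exists>D. D \<in>\<^sub>V B \<and> D \<subseteq>\<^sub>V A \<and> D \<subseteq>\<^sub>V C))"

definition vgenerated_filter :: "'v::ZF \<Rightarrow> 'v \<Rightarrow> 'v" where
  "vgenerated_filter X B = vcollect (\<lambda>S. S \<subseteq>\<^sub>V X \<and> (\<exists>A. A \<in>\<^sub>V B \<and> A \<subseteq>\<^sub>V S))"

definition vfilter :: "'v::ZF \<Rightarrow> 'v \<Rightarrow> bool" where
  "vfilter Z U \<longleftrightarrow> U \<subseteq>\<^sub>V vPow Z \<and> Z \<in>\<^sub>V U \<and>
     (\<forall>S. S \<in>\<^sub>V U \<longrightarrow> vnonempty S) \<and>
     (\<forall>S T. S \<in>\<^sub>V U \<and> S \<subseteq>\<^sub>V T \<and> T \<subseteq>\<^sub>V Z \<longrightarrow> T \<in>\<^sub>V U) \<and>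
     (\<forall>S T. S \<in>\<^sub>V U \<and> T \<in>\<^sub>V U \<longrightarrow> S \<inter>\<^sub>V T \<in>\<^sub>V U)"

text \<open>Here \<open>U\<close> is a filter on the power set of \<open>B\<close>.\<close>

definition vfine :: "'v::ZF \<Rightarrow> 'v \<Rightarrow> bool" where
  "vfine B U \<longleftrightarrow> (\<forall>A. A \<in>\<^sub>V B \<longrightarrow> vcollect (\<lambda>\<sigma>. \<sigma> \<subseteq>\<^sub>V B \<and> A \<in>\<^sub>V \<sigma>) \<in>\<^sub>V U)"

definition vdescendingly_closed :: "'v::ZF \<Rightarrow> 'v \<Rightarrow> 'v \<Rightarrow> bool" where
  "vdescendingly_closed Z \<gamma> U \<longleftrightarrow>
     (\<forall>f. vfun f \<gamma> U \<and>
          (\<forall>\<xi> \<eta>. \<xi> \<in>\<^sub>V \<gamma> \<and> \<eta> \<in>\<^sub>V \<gamma> \<and> \<xi> \<in>\<^sub>V \<eta> \<longrightarrow> vapp f \<eta> \<subseteq>\<^sub>V vapp f \<xi>)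
        \<longrightarrow> vseqInter Z \<gamma> f \<in>\<^sub>V U)"

definition vconcentrates_on :: "'v::ZF \<Rightarrow> 'v \<Rightarrow> bool" where
  "vconcentrates_on U S \<longleftrightarrow> S \<in>\<^sub>V U"

definition vclosed :: "'v::ZF \<Rightarrow> 'v \<Rightarrow> 'v \<Rightarrow> bool" where
  "vclosed X \<beta> F \<longleftrightarrow> (\<forall>A. vfun A \<beta> F \<longrightarrow> vseqInter X \<beta> A \<in>\<^sub>V F)"

end

theory Submission
  imports Defs
begin

text \<open>
  Let \<open>\<delta> \<le> \<beta>\<close> be least such that the filter is not \<open>\<delta>\<close>-closed.  As the filter is closed under
  binary intersections, \<open>\<delta>\<close> is neither zero nor a successor.  If \<open>h : \<eta> \<rightarrow> \<delta>\<close> were cofinal with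
  \<open>\<eta> < \<delta>\<close>, then \<open>\<Inter>\<^sub>\<xi>\<^sub><\<^sub>\<delta> A\<^sub>\<xi>\<close> would be the intersection of the sets \<open>\<Inter>{A\<^sub>\<xi> | \<xi> \<le> h(i)}\<close> for \<open>i < \<eta>\<close>,
  and so would belong to the filter.  Hence \<open>\<delta>\<close> is a regular cardinal, and there is a filter \<open>U\<close>
  as in the hypothesis with \<open>\<gamma> = \<delta>\<close>.  The sets \<open>S\<^sub>i\<close> of all \<open>\<sigma>\<close> with \<open>\<Inter>\<sigma> \<subseteq> \<Inter>{A\<^sub>\<xi> | \<xi> \<le> i}\<close> decrease
  and belong to \<open>U\<close> by fineness, so some \<open>\<sigma>\<close> in all of them has \<open>\<Inter>\<sigma> \<in> \<B>\<close>; this \<open>\<Inter>\<sigma>\<close> is contained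
  in every \<open>A\<^sub>\<xi>\<close>.
\<close>

section \<open>Definability with parameters\<close>

text \<open>Under \<open>Ex\<close> the bound variable 0 stays fixed and every other index is
  shifted past it. Renaming is what allows formulas with different assignments of variables to be
  combined.\<close>

primrec rename :: "(nat \<Rightarrow> nat) \<Rightarrow> fm \<Rightarrow> fm" where
  "rename r (Mem i j) = Mem (r i) (r j)"
| "rename r (Equal i j) = Equal (r i) (r j)"
| "rename r (Neg p) = Neg (rename r p)"
| "rename r (Conj p q) = Conj (rename r p) (rename r q)"
| "rename r (Ex p) = Ex (rename (case_nat 0 (\<lambda>n. Suc (r n))) p)"

lemma sat_rename: "sat E (rename r p) e \<longleftrightarrow> sat E p (\<lambda>n. e (r n))"
proof (induction p arbitrary: r e)
  case (Ex p)
  have "(\<lambda>n. case_nat x e (case_nat 0 (\<lambda>n. Suc (r n)) n)) = case_nat x (\<lambda>n. e (r n))" for x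
    by (auto split: nat.split)
  then show ?case
    by (simp add: Ex.IH)
qed simp_all

text \<open>
  A value of type \<open>nat + 'v\<close> is either a variable, to be read from the environment, or a
  parameter.
\<close>

definition lookup :: "(nat \<Rightarrow> 'v) \<Rightarrow> nat + 'v \<Rightarrow> 'v" where
  "lookup e s = case_sum e (\<lambda>c. c) s"

definition simple_term :: "((nat \<Rightarrow> 'v) \<Rightarrow> 'v) \<Rightarrow> bool" where
  "simple_term t \<longleftrightarrow> (\<exists>s. t = (\<lambda>e. lookup e s))"

text \<open>The function \<open>f\<close> wires each variable of \<open>p\<close> to a variable of
  \<open>e\<close> or to a parameter. Predicates can thus stay HOL predicates with constants in
  them, and their definability follows by rules directed by their syntax.\<close>

definition definable :: "((nat \<Rightarrow> 'v::ZF) \<Rightarrow> bool) \<Rightarrow> bool" where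
  "definable P \<longleftrightarrow> (\<exists>p f. \<forall>e. P e \<longleftrightarrow> sat (\<in>\<^sub>V) p (\<lambda>n. lookup e (f n)))"

lemma simple_term_var: "simple_term (\<lambda>e. e i)"
  unfolding simple_term_def lookup_def by (rule exI[of _ "Inl i"]) simp

lemma simple_term_const: "simple_term (\<lambda>e. c)"
  unfolding simple_term_def lookup_def by (rule exI[of _ "Inr c"]) simp

text \<open>Needed below a quantifier, where the outer environment is the tail of the current one: a
  variable index grows by one and a parameter is unchanged.\<close>

lemma simple_term_shift:
  assumes "simple_term t"
  shows "simple_term (\<lambda>e. t (\<lambda>n. e (Suc n)))"
proof -
  obtain s where "t = (\<lambda>e. lookup e s)"
    using assms unfolding simple_term_def by blast
  then have "(\<lambda>e. t (\<lambda>n. e (Suc n))) = (\<lambda>e. lookup e (map_sum Suc (\<lambda>c. c) s))"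
    by (cases s) (auto simp: lookup_def)
  then show ?thesis
    unfolding simple_term_def by blast
qed

lemma definable_mem:
  assumes "simple_term s" "simple_term t"
  shows "definable (\<lambda>e. s e \<in>\<^sub>V t e)"
proof -
  obtain a b where "s = (\<lambda>e. lookup e a)" "t = (\<lambda>e. lookup e b)"
    using assms unfolding simple_term_def by blast
  then show ?thesis
    unfolding definable_def
    by (intro exI[of _ "Mem 0 1"] exI[of _ "case_nat a (\<lambda>_. b)"]) simp
qed

lemma definable_eq:
  assumes "simple_term s" "simple_term t"
  shows "definable (\<lambda>e. s e = t e)"
proof -
  obtain a b where "s = (\<lambda>e. lookup e a)" "t = (\<lambda>e. lookup e b)"
    using assms unfolding simple_term_def by blast
  then show ?thesis
    unfolding definable_def
    by (intro exI[of _ "Equal 0 1"] exI[of _ "case_nat a (\<lambda>_. b)"]) simp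
qed

lemma definable_not:
  assumes "definable P"
  shows "definable (\<lambda>e. \<not> P e)"
proof -
  obtain p f where "\<And>e. P e \<longleftrightarrow> sat (\<in>\<^sub>V) p (\<lambda>n. lookup e (f n))"
    using assms unfolding definable_def by blast
  then show ?thesis
    unfolding definable_def by (intro exI[of _ "Neg p"] exI[of _ f]) simp
qed

lemma definable_conj:
  assumes "definable P" "definable Q"
  shows "definable (\<lambda>e. P e \<and> Q e)"
proof -
  obtain p f q g where p: "\<And>e. P e \<longleftrightarrow> sat (\<in>\<^sub>V) p (\<lambda>n. lookup e (f n))"
    and q: "\<And>e. Q e \<longleftrightarrow> sat (\<in>\<^sub>V) q (\<lambda>n. lookup e (g n))"
    using assms unfolding definable_def by blast
  show ?thesis
    unfolding definable_def
    \<comment> \<open>The two formulas may wire the same variable differently, so their variables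
      are separated: even indices for \<open>p\<close>, odd ones for \<open>q\<close>.\<close>
    by (intro exI[of _ "Conj (rename (\<lambda>n. 2 * n) p) (rename (\<lambda>n. 2 * n + 1) q)"]
          exI[of _ "\<lambda>n. if even n then f (n div 2) else g (n div 2)"])
      (simp add: sat_rename p q)
qed

lemma definable_ex:
  assumes "definable (\<lambda>e. P (e 0) (\<lambda>n. e (Suc n)))"
  shows "definable (\<lambda>e. \<exists>x. P x e)"
proof -
  obtain p f where p: "\<And>e. P (e 0) (\<lambda>n. e (Suc n)) \<longleftrightarrow> sat (\<in>\<^sub>V) p (\<lambda>n. lookup e (f n))"
    using assms unfolding definable_def by blast
  \<comment> \<open>Every variable wired to the quantified variable becomes the bound variable 0.
    The others move up by one, and \<open>g\<close> lowers their outer index instead. For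
    \<open>f n = Inl 0\<close> the truncated \<open>i - 1\<close> is a dummy value that is never
    read.\<close>
  define r where "r n = (if f n = Inl 0 then 0 else Suc n)" for n
  define g where "g n = map_sum (\<lambda>i. i - 1) (\<lambda>c. c) (f n)" for n
  have env: "case_nat x (\<lambda>n. lookup e (g n)) (r n) = lookup (case_nat x e) (f n)" for x e n
    by (auto simp: r_def g_def lookup_def split: sum.split nat.split)
  have "P x e \<longleftrightarrow> sat (\<in>\<^sub>V) (rename r p) (case_nat x (\<lambda>n. lookup e (g n)))" for x e
    using p[of "case_nat x e"] by (simp add: sat_rename env)
  then show ?thesis
    unfolding definable_def by (intro exI[of _ "Ex (rename r p)"] exI[of _ g]) simp
qed

lemma definable_disj:
  assumes "definable P" "definable Q"
  shows "definable (\<lambda>e. P e \<or> Q e)"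
  using definable_not[OF definable_conj[OF definable_not definable_not, OF assms]] by simp

lemma definable_imp:
  assumes "definable P" "definable Q"
  shows "definable (\<lambda>e. P e \<longrightarrow> Q e)"
  unfolding imp_conv_disj by (intro definable_disj definable_not assms)

lemma definable_iff:
  assumes "definable P" "definable Q"
  shows "definable (\<lambda>e. P e \<longleftrightarrow> Q e)"
  unfolding iff_conv_conj_imp by (intro definable_conj definable_imp assms)

lemma definable_all:
  assumes "definable (\<lambda>e. P (e 0) (\<lambda>n. e (Suc n)))"
  shows "definable (\<lambda>e. \<forall>x. P x e)"
  unfolding all_not_ex by (intro definable_not definable_ex assms)

lemmas definable_intros =
  definable_mem definable_eq definable_not definable_conj definable_disj definable_imp
  definable_iff definable_ex definable_all
  simple_term_var simple_term_const

lemma definable_separation: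
  fixes a :: "'v::ZF"
  assumes "definable (\<lambda>e. P (e 0))"
  shows "\<exists>b. \<forall>x. x \<in>\<^sub>V b \<longleftrightarrow> x \<in>\<^sub>V a \<and> P x"
proof -
  obtain p f where p: "\<And>e. P (e 0) \<longleftrightarrow> sat (\<in>\<^sub>V) p (\<lambda>n. lookup e (f n))"
    using assms unfolding definable_def by blast
  define r where "r n = (case f n of Inl i \<Rightarrow> if i = 0 then 0 else Suc n | Inr c \<Rightarrow> Suc n)" for n
  \<comment> \<open>\<open>P\<close> depends on \<open>e 0\<close> alone, so the remaining variables
    may take any value; \<open>a\<close> is at hand.\<close>
  define g where "g n = lookup (\<lambda>_. a) (f n)" for n
  have env: "case_nat x g (r n) = lookup (case_nat x (\<lambda>_. a)) (f n)" for x n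
    by (auto simp: r_def g_def lookup_def split: sum.split nat.split)
  have "P x \<longleftrightarrow> sat (\<in>\<^sub>V) (rename r p) (case_nat x g)" for x
    using p[of "case_nat x (\<lambda>_. a)"] by (simp add: sat_rename env)
  then show ?thesis
    using separation[of a "rename r p" g] by simp
qed

section \<open>Sets, pairs and functions in a model of ZF\<close>

lemma mem_vcollect:
  assumes "\<exists>a. \<forall>x. x \<in>\<^sub>V a \<longleftrightarrow> P x"
  shows "x \<in>\<^sub>V vcollect P \<longleftrightarrow> P x"
proof -
  obtain a where a: "\<forall>x. x \<in>\<^sub>V a \<longleftrightarrow> P x"
    using assms by blast
  have "\<forall>x. x \<in>\<^sub>V vcollect P \<longleftrightarrow> P x"
    unfolding vcollect_def using a by (rule theI) (rule extensionality, simp add: a)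
  then show ?thesis ..
qed

lemma mem_vcollect_definable:
  assumes "definable (\<lambda>e. P (e 0))" and "\<And>x. P x \<Longrightarrow> x \<in>\<^sub>V a"
  shows "x \<in>\<^sub>V vcollect P \<longleftrightarrow> P x"
proof (rule mem_vcollect)
  show "\<exists>b. \<forall>x. x \<in>\<^sub>V b \<longleftrightarrow> P x"
    using definable_separation[OF assms(1), of a] assms(2) by blast
qed

lemma mem_vPow: "x \<in>\<^sub>V vPow a \<longleftrightarrow> x \<subseteq>\<^sub>V a"
  unfolding vPow_def by (rule mem_vcollect) (simp add: vsubset_def power)

lemma mem_vupair: "x \<in>\<^sub>V vupair a b \<longleftrightarrow> x = a \<or> x = b"
  unfolding vupair_def by (rule mem_vcollect) (rule pairing)

lemma mem_vint: "x \<in>\<^sub>V a \<inter>\<^sub>V b \<longleftrightarrow> x \<in>\<^sub>V a \<and> x \<in>\<^sub>V b"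
  unfolding vint_def by (rule mem_vcollect_definable[where a = a]) (intro definable_intros, blast)

lemma mem_vInter: "x \<in>\<^sub>V vInter X s \<longleftrightarrow> x \<in>\<^sub>V X \<and> (\<forall>A. A \<in>\<^sub>V s \<longrightarrow> x \<in>\<^sub>V A)"
  unfolding vInter_def
  by (rule mem_vcollect_definable[where a = X]) (intro definable_intros, blast)

text \<open>Terms of definable predicates are only variables and parameters. An equation with
  \<open>vInter\<close> must therefore be expressed through membership.\<close>

lemma eq_vInter_iff:
  "D = vInter X s \<longleftrightarrow> (\<forall>x. x \<in>\<^sub>V D \<longleftrightarrow> x \<in>\<^sub>V X \<and> (\<forall>A. A \<in>\<^sub>V s \<longrightarrow> x \<in>\<^sub>V A))"
  unfolding mem_vInter[symmetric] using extensionality by blast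

lemma mem_vgenerated_filter:
  "S \<in>\<^sub>V vgenerated_filter X B \<longleftrightarrow> S \<subseteq>\<^sub>V X \<and> (\<exists>A. A \<in>\<^sub>V B \<and> A \<subseteq>\<^sub>V S)"
  unfolding vgenerated_filter_def vsubset_def
  by (rule mem_vcollect_definable[where a = "vPow X"])
    (intro definable_intros, simp add: mem_vPow vsubset_def)

lemma eq_vupair_iff: "p = vupair a b \<longleftrightarrow> (\<forall>x. x \<in>\<^sub>V p \<longleftrightarrow> x = a \<or> x = b)"
  by (metis extensionality mem_vupair)

lemma vupair_eq_iff: "vupair a b = vupair c d \<longleftrightarrow> a = c \<and> b = d \<or> a = d \<and> b = c"
  by (metis mem_vupair extensionality)

lemma vpair_inject: "vpair a b = vpair c d \<longleftrightarrow> a = c \<and> b = d"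
  unfolding vpair_def vupair_eq_iff by blast

lemma definable_eq_vpair:
  assumes "simple_term p" "simple_term s" "simple_term t"
  shows "definable (\<lambda>e. p e = vpair (s e) (t e))"
  unfolding vpair_def eq_vupair_iff
  by (intro definable_intros simple_term_shift assms)

lemma definable_vpair_mem:
  assumes "simple_term s" "simple_term t" "simple_term u"
  shows "definable (\<lambda>e. vpair (s e) (t e) \<in>\<^sub>V u e)"
proof -
  \<comment> \<open>The compound term is replaced by a quantified variable equal to it.\<close>
  have "definable (\<lambda>e. \<exists>p. p = vpair (s e) (t e) \<and> p \<in>\<^sub>V u e)"
    by (intro definable_intros definable_eq_vpair simple_term_shift assms)
  then show ?thesis
    by simp
qed

text \<open>Provides a bounding set of pairs from which Separation can cut out a relation.\<close>

lemma vpair_mem_vPow_vPow: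
  assumes "x \<in>\<^sub>V c" "y \<in>\<^sub>V c"
  shows "vpair x y \<in>\<^sub>V vPow (vPow c)"
  using assms by (auto simp: mem_vPow vsubset_def vpair_def mem_vupair)

text \<open>Variables are de Bruijn indices, so \<open>e (Suc 0)\<close> is the first component of the pair.\<close>

lemma definable_relation:
  fixes a b :: "'v::ZF"
  assumes "definable (\<lambda>e. P (e (Suc 0)) (e 0))"
  obtains R where "\<And>x y. vpair x y \<in>\<^sub>V R \<longleftrightarrow> x \<in>\<^sub>V a \<and> y \<in>\<^sub>V b \<and> P x y"
    and "\<And>p. p \<in>\<^sub>V R \<Longrightarrow> \<exists>x y. x \<in>\<^sub>V a \<and> y \<in>\<^sub>V b \<and> p = vpair x y"
proof -
  obtain c where c: "\<forall>x. x \<in>\<^sub>V c \<longleftrightarrow> x \<in>\<^sub>V a \<or> x \<in>\<^sub>V b"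
    using union[of "vupair a b"] by (auto simp: mem_vupair)
  have "definable (\<lambda>e. \<exists>x y. e 0 = vpair x y \<and> x \<in>\<^sub>V a \<and> y \<in>\<^sub>V b \<and> P x y)"
    by (intro definable_intros definable_eq_vpair assms)
  from definable_separation[OF this, of "vPow (vPow c)"] obtain R
    where R: "\<And>p. p \<in>\<^sub>V R \<longleftrightarrow> p \<in>\<^sub>V vPow (vPow c) \<and>
      (\<exists>x y. p = vpair x y \<and> x \<in>\<^sub>V a \<and> y \<in>\<^sub>V b \<and> P x y)"
    by blast
  show ?thesis
  proof (rule that)
    show "vpair x y \<in>\<^sub>V R \<longleftrightarrow> x \<in>\<^sub>V a \<and> y \<in>\<^sub>V b \<and> P x y" for x y
      using vpair_mem_vPow_vPow[of x c y] c unfolding R vpair_inject by blast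
    show "\<exists>x y. x \<in>\<^sub>V a \<and> y \<in>\<^sub>V b \<and> p = vpair x y" if "p \<in>\<^sub>V R" for p
      using that R by blast
  qed
qed

lemma vapp_eqI:
  assumes "vfun f a b" "x \<in>\<^sub>V a" "vpair x y \<in>\<^sub>V f"
  shows "vapp f x = y"
  unfolding vapp_def by (rule the1_equality) (use assms in \<open>simp_all add: vfun_def\<close>)

lemma vapp_vpair_mem:
  assumes "vfun f a b" "x \<in>\<^sub>V a"
  shows "vpair x (vapp f x) \<in>\<^sub>V f"
  unfolding vapp_def by (rule theI') (use assms in \<open>simp add: vfun_def\<close>)

lemma vapp_mem:
  assumes "vfun f a b" "x \<in>\<^sub>V a"
  shows "vapp f x \<in>\<^sub>V b"
proof -
  obtain x' y where "y \<in>\<^sub>V b" "vpair x (vapp f x) = vpair x' y"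
    using assms(1) vapp_vpair_mem[OF assms] unfolding vfun_def by blast
  then show ?thesis
    unfolding vpair_inject by blast
qed

text \<open>Uniqueness of the value turns the definable relation into a function, so no choice
  enters.\<close>

lemma definable_function:
  fixes a b :: "'v::ZF"
  assumes "definable (\<lambda>e. P (e (Suc 0)) (e 0))"
    and "\<And>x. x \<in>\<^sub>V a \<Longrightarrow> \<exists>!y. y \<in>\<^sub>V b \<and> P x y"
  obtains f where "vfun f a b" "\<And>x. x \<in>\<^sub>V a \<Longrightarrow> P x (vapp f x)"
proof -
  obtain f where f: "\<And>x y. vpair x y \<in>\<^sub>V f \<longleftrightarrow> x \<in>\<^sub>V a \<and> y \<in>\<^sub>V b \<and> P x y"
    and f': "\<And>p. p \<in>\<^sub>V f \<Longrightarrow> \<exists>x y. x \<in>\<^sub>V a \<and> y \<in>\<^sub>V b \<and> p = vpair x y"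
    using definable_relation[OF assms(1)] by blast
  have "vfun f a b"
    using f f' assms(2) by (simp add: vfun_def)
  with f vapp_vpair_mem show ?thesis
    by (blast intro: that)
qed

text \<open>\<open>vapp\<close> is a description, to which Separation does not apply directly. For a
  function it can be replaced by a quantifier over the pairs in \<open>f\<close>.\<close>

lemma mem_vseqInter:
  assumes "vfun f \<gamma> F"
  shows "x \<in>\<^sub>V vseqInter X \<gamma> f \<longleftrightarrow> x \<in>\<^sub>V X \<and> (\<forall>\<xi>. \<xi> \<in>\<^sub>V \<gamma> \<longrightarrow> x \<in>\<^sub>V vapp f \<xi>)"
proof -
  have "(\<forall>\<xi>. \<xi> \<in>\<^sub>V \<gamma> \<longrightarrow> x \<in>\<^sub>V vapp f \<xi>) \<longleftrightarrow>
      (\<forall>\<xi>. \<xi> \<in>\<^sub>V \<gamma> \<longrightarrow> (\<exists>y. vpair \<xi> y \<in>\<^sub>V f \<and> x \<in>\<^sub>V y))" for x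
    using vapp_eqI[OF assms] vapp_vpair_mem[OF assms] by metis
  note eq = this
  show ?thesis
    unfolding vseqInter_def eq
    by (rule mem_vcollect_definable[where a = X])
      (intro definable_intros definable_vpair_mem, blast)
qed

section \<open>Ordinals and their elements\<close>

lemma vordinal_transitive: "vordinal \<beta> \<Longrightarrow> \<delta> \<in>\<^sub>V \<beta> \<Longrightarrow> \<xi> \<in>\<^sub>V \<delta> \<Longrightarrow> \<xi> \<in>\<^sub>V \<beta>"
  unfolding vordinal_def vsubset_def by blast

lemma vordinal_irrefl:
  assumes "vordinal \<beta>" "\<delta> \<in>\<^sub>V \<beta>"
  shows "\<not> \<delta> \<in>\<^sub>V \<delta>"
proof -
  have "\<forall>x. x \<in>\<^sub>V \<beta> \<longrightarrow> \<not> x \<in>\<^sub>V x"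
    using assms(1) unfolding vordinal_def by (elim conjE)
  with assms(2) show ?thesis
    by blast
qed

lemma vordinal_mem:
  assumes "vordinal \<beta>" "\<delta> \<in>\<^sub>V \<beta>"
  shows "vordinal \<delta>"
proof -
  have sub: "x \<in>\<^sub>V \<beta>" if "x \<in>\<^sub>V \<delta>" for x
    using vordinal_transitive[OF assms that] .
  have trans: "\<forall>x y z. x \<in>\<^sub>V \<beta> \<and> y \<in>\<^sub>V \<beta> \<and> z \<in>\<^sub>V \<beta> \<and> x \<in>\<^sub>V y \<and> y \<in>\<^sub>V z \<longrightarrow> x \<in>\<^sub>V z"
    and linear: "\<forall>x y. x \<in>\<^sub>V \<beta> \<and> y \<in>\<^sub>V \<beta> \<longrightarrow> x \<in>\<^sub>V y \<or> x = y \<or> y \<in>\<^sub>V x"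
    and least: "\<forall>s. s \<subseteq>\<^sub>V \<beta> \<and> vnonempty s \<longrightarrow>
      (\<exists>x. x \<in>\<^sub>V s \<and> (\<forall>y. y \<in>\<^sub>V s \<longrightarrow> x = y \<or> x \<in>\<^sub>V y))"
    using assms(1) unfolding vordinal_def by - (elim conjE, assumption)+
  have subset: "x \<subseteq>\<^sub>V \<delta>" if "x \<in>\<^sub>V \<delta>" for x
    unfolding vsubset_def
    using trans assms(2) sub[OF that] vordinal_transitive[OF assms(1) sub[OF that]] that by blast
  have "s \<subseteq>\<^sub>V \<beta>" if "s \<subseteq>\<^sub>V \<delta>" for s
    using that sub unfolding vsubset_def by blast
  with least have "\<forall>s. s \<subseteq>\<^sub>V \<delta> \<and> vnonempty s \<longrightarrow>
      (\<exists>x. x \<in>\<^sub>V s \<and> (\<forall>y. y \<in>\<^sub>V s \<longrightarrow> x = y \<or> x \<in>\<^sub>V y))"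
    by simp
  moreover have "\<forall>x y z. x \<in>\<^sub>V \<delta> \<and> y \<in>\<^sub>V \<delta> \<and> z \<in>\<^sub>V \<delta> \<and> x \<in>\<^sub>V y \<and> y \<in>\<^sub>V z \<longrightarrow> x \<in>\<^sub>V z"
    using trans sub by blast
  moreover have "\<forall>x y. x \<in>\<^sub>V \<delta> \<and> y \<in>\<^sub>V \<delta> \<longrightarrow> x \<in>\<^sub>V y \<or> x = y \<or> y \<in>\<^sub>V x"
    using linear sub by simp
  moreover have "\<forall>x. x \<in>\<^sub>V \<delta> \<longrightarrow> \<not> x \<in>\<^sub>V x"
    using sub vordinal_irrefl[OF assms(1)] by simp
  moreover have "\<forall>x. x \<in>\<^sub>V \<delta> \<longrightarrow> x \<subseteq>\<^sub>V \<delta>"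
    using subset by blast
  ultimately show ?thesis
    unfolding vordinal_def by - (intro conjI)
qed

section \<open>Closure of the filter in terms of its base\<close>

text \<open>
  Sequences of sets are coded by binary relations: \<open>R\<close> stands for the sequence whose \<open>\<xi>\<close>-th set
  is \<open>{x | (\<xi>, x) \<in> R}\<close>.
\<close>

definition base_closed :: "'v::ZF \<Rightarrow> 'v \<Rightarrow> bool" where
  "base_closed B \<delta> \<longleftrightarrow>
     (\<forall>R. (\<forall>\<xi>. \<xi> \<in>\<^sub>V \<delta> \<longrightarrow> (\<exists>A. A \<in>\<^sub>V B \<and> (\<forall>x. x \<in>\<^sub>V A \<longrightarrow> vpair \<xi> x \<in>\<^sub>V R))) \<longrightarrow>
          (\<exists>A. A \<in>\<^sub>V B \<and> (\<forall>x. x \<in>\<^sub>V A \<longrightarrow> (\<forall>\<xi>. \<xi> \<in>\<^sub>V \<delta> \<longrightarrow> vpair \<xi> x \<in>\<^sub>V R))))"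

lemma base_closedE:
  assumes "base_closed B \<delta>"
    and "\<And>\<xi>. \<xi> \<in>\<^sub>V \<delta> \<Longrightarrow> \<exists>A. A \<in>\<^sub>V B \<and> (\<forall>x. x \<in>\<^sub>V A \<longrightarrow> vpair \<xi> x \<in>\<^sub>V R)"
  obtains A where "A \<in>\<^sub>V B" "\<And>x \<xi>. x \<in>\<^sub>V A \<Longrightarrow> \<xi> \<in>\<^sub>V \<delta> \<Longrightarrow> vpair \<xi> x \<in>\<^sub>V R"
proof -
  have "\<forall>\<xi>. \<xi> \<in>\<^sub>V \<delta> \<longrightarrow> (\<exists>A. A \<in>\<^sub>V B \<and> (\<forall>x. x \<in>\<^sub>V A \<longrightarrow> vpair \<xi> x \<in>\<^sub>V R))"
    using assms(2) by blast
  from assms(1)[unfolded base_closed_def, THEN spec, THEN mp, OF this] show ?thesis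
    using that by blast
qed

section \<open>The least ordinal at which closure fails\<close>

lemma least_not_base_closed:
  assumes "vordinal \<beta>" "\<not> base_closed B \<beta>"
  obtains \<delta> where "vordinal \<delta>" "\<delta> \<le>\<^sub>V \<beta>" "\<not> base_closed B \<delta>"
    "\<And>\<eta>. \<eta> \<in>\<^sub>V \<delta> \<Longrightarrow> base_closed B \<eta>"
proof (cases "\<forall>\<eta>. \<eta> \<in>\<^sub>V \<beta> \<longrightarrow> base_closed B \<eta>")
  case True
  with assms show ?thesis
    by (intro that[of \<beta>]) (auto simp: vord_le_def)
next
  case False
  \<comment> \<open>An ordinal has least elements only for subsets that are elements of the model,
    so the set of failures has to come from Separation.\<close>
  have "definable (\<lambda>e. \<not> base_closed B (e 0))"
    unfolding base_closed_def by (intro definable_intros definable_vpair_mem)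
  from definable_separation[OF this, of \<beta>]
  obtain s where s: "\<And>\<eta>. \<eta> \<in>\<^sub>V s \<longleftrightarrow> \<eta> \<in>\<^sub>V \<beta> \<and> \<not> base_closed B \<eta>"
    by blast
  have "s \<subseteq>\<^sub>V \<beta> \<and> vnonempty s"
    using s False by (auto simp: vsubset_def vnonempty_def)
  then obtain \<delta> where \<delta>: "\<delta> \<in>\<^sub>V s" and least: "\<And>\<eta>. \<eta> \<in>\<^sub>V s \<Longrightarrow> \<delta> = \<eta> \<or> \<delta> \<in>\<^sub>V \<eta>"
    using assms(1) unfolding vordinal_def by blast
  have "base_closed B \<eta>" if \<eta>: "\<eta> \<in>\<^sub>V \<delta>" for \<eta>
  proof (rule ccontr)
    assume "\<not> base_closed B \<eta>"
    moreover have \<delta>\<beta>: "\<delta> \<in>\<^sub>V \<beta>"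
      using \<delta> s by blast
    moreover have "\<eta> \<in>\<^sub>V \<beta>"
      using vordinal_transitive[OF assms(1) \<delta>\<beta> \<eta>] .
    ultimately have "\<delta> = \<eta> \<or> \<delta> \<in>\<^sub>V \<eta>"
      using s least by blast
    then have "\<delta> \<in>\<^sub>V \<delta>"
      using \<eta> vordinal_transitive[OF vordinal_mem[OF assms(1) \<delta>\<beta>] \<eta>] by blast
    then show False
      using vordinal_irrefl[OF assms(1) \<delta>\<beta>] by blast
  qed
  then show ?thesis
    using \<delta> s vordinal_mem[OF assms(1)] by (intro that[of \<delta>]) (auto simp: vord_le_def)
qed

text \<open>Directedness of the base merges a set for the indices in \<open>\<eta>\<close> with one
  for the index \<open>\<eta>\<close>. This serves both successor ordinals and the initial segments
  of all \<open>\<xi> \<le> i\<close>.\<close>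

lemma base_closed_insert:
  assumes "vfilter_base X B" "base_closed B \<eta>"
    and "\<And>\<xi>. \<xi> \<in>\<^sub>V \<eta> \<or> \<xi> = \<eta> \<Longrightarrow> \<exists>A. A \<in>\<^sub>V B \<and> (\<forall>x. x \<in>\<^sub>V A \<longrightarrow> vpair \<xi> x \<in>\<^sub>V R)"
  shows "\<exists>A. A \<in>\<^sub>V B \<and> (\<forall>x. x \<in>\<^sub>V A \<longrightarrow> (\<forall>\<xi>. \<xi> \<in>\<^sub>V \<eta> \<or> \<xi> = \<eta> \<longrightarrow> vpair \<xi> x \<in>\<^sub>V R))"
proof -
  obtain A where A: "A \<in>\<^sub>V B" "\<And>x \<xi>. x \<in>\<^sub>V A \<Longrightarrow> \<xi> \<in>\<^sub>V \<eta> \<Longrightarrow> vpair \<xi> x \<in>\<^sub>V R"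
    using base_closedE[OF assms(2), of R] assms(3) by blast
  obtain C where C: "C \<in>\<^sub>V B" "\<And>x. x \<in>\<^sub>V C \<Longrightarrow> vpair \<eta> x \<in>\<^sub>V R"
    using assms(3) by blast
  obtain D where "D \<in>\<^sub>V B" "D \<subseteq>\<^sub>V A" "D \<subseteq>\<^sub>V C"
    using assms(1) A(1) C(1) unfolding vfilter_base_def by blast
  then show ?thesis
    using A(2) C(2) unfolding vsubset_def by blast
qed

lemma base_mem_subset: "vfilter_base X B \<Longrightarrow> A \<in>\<^sub>V B \<Longrightarrow> x \<in>\<^sub>V A \<Longrightarrow> x \<in>\<^sub>V X"
  unfolding vfilter_base_def vsubset_def mem_vPow by blast

text \<open>The intersection is regrouped into blocks. Block \<open>i\<close> takes the indices up
  to \<open>h(i)\<close> and is handled by closure at \<open>h(i)\<close>; closure at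
  \<open>\<eta>\<close> then handles all the blocks, which cover \<open>\<delta>\<close> by
  cofinality.\<close>

lemma base_closed_cofinal:
  assumes B: "vfilter_base X B"
    and \<delta>: "vordinal \<delta>" and closed: "\<And>\<eta>. \<eta> \<in>\<^sub>V \<delta> \<Longrightarrow> base_closed B \<eta>"
    and \<eta>: "\<eta> \<in>\<^sub>V \<delta>" and h: "vcofinal_map h \<eta> \<delta>"
  shows "base_closed B \<delta>"
  unfolding base_closed_def
proof (intro allI impI)
  fix R
  assume R: "\<forall>\<xi>. \<xi> \<in>\<^sub>V \<delta> \<longrightarrow> (\<exists>A. A \<in>\<^sub>V B \<and> (\<forall>x. x \<in>\<^sub>V A \<longrightarrow> vpair \<xi> x \<in>\<^sub>V R))"
  have fun_h: "vfun h \<eta> \<delta>"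
    and cof: "\<And>\<xi>. \<xi> \<in>\<^sub>V \<delta> \<Longrightarrow> \<exists>i. i \<in>\<^sub>V \<eta> \<and> (\<xi> \<in>\<^sub>V vapp h i \<or> \<xi> = vapp h i)"
    using h unfolding vcofinal_map_def vord_le_def by auto
  \<comment> \<open>The relation \<open>Q\<close> codes the sequence of block intersections. It is
    defined from \<open>R\<close> and \<open>h\<close> alone, so no base sets have to be chosen for
    the blocks.\<close>
  have "definable (\<lambda>e. \<forall>\<zeta>. vpair (e (Suc 0)) \<zeta> \<in>\<^sub>V h \<longrightarrow>
      (\<forall>\<xi>. \<xi> \<in>\<^sub>V \<zeta> \<or> \<xi> = \<zeta> \<longrightarrow> vpair \<xi> (e 0) \<in>\<^sub>V R))"
    by (intro definable_intros definable_vpair_mem)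
  then obtain Q where Q: "\<And>i x. vpair i x \<in>\<^sub>V Q \<longleftrightarrow> i \<in>\<^sub>V \<eta> \<and> x \<in>\<^sub>V X \<and>
      (\<forall>\<zeta>. vpair i \<zeta> \<in>\<^sub>V h \<longrightarrow> (\<forall>\<xi>. \<xi> \<in>\<^sub>V \<zeta> \<or> \<xi> = \<zeta> \<longrightarrow> vpair \<xi> x \<in>\<^sub>V R))"
    by (rule definable_relation) blast
  have "\<exists>A. A \<in>\<^sub>V B \<and> (\<forall>x. x \<in>\<^sub>V A \<longrightarrow> vpair i x \<in>\<^sub>V Q)" if i: "i \<in>\<^sub>V \<eta>" for i
  proof -
    have hi: "vapp h i \<in>\<^sub>V \<delta>"
      using vapp_mem[OF fun_h i] .
    have "\<exists>A. A \<in>\<^sub>V B \<and>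
        (\<forall>x. x \<in>\<^sub>V A \<longrightarrow> (\<forall>\<xi>. \<xi> \<in>\<^sub>V vapp h i \<or> \<xi> = vapp h i \<longrightarrow> vpair \<xi> x \<in>\<^sub>V R))"
      by (rule base_closed_insert[OF B closed[OF hi]]) (use R hi vordinal_transitive[OF \<delta> hi] in blast)
    then obtain A where "A \<in>\<^sub>V B"
      and A: "\<And>x \<xi>. x \<in>\<^sub>V A \<Longrightarrow> \<xi> \<in>\<^sub>V vapp h i \<or> \<xi> = vapp h i \<Longrightarrow> vpair \<xi> x \<in>\<^sub>V R"
      by blast
    have "vpair i x \<in>\<^sub>V Q" if "x \<in>\<^sub>V A" for x
      unfolding Q
      using i base_mem_subset[OF B \<open>A \<in>\<^sub>V B\<close> that] A[OF that]
      by (auto dest!: vapp_eqI[OF fun_h i])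
    then show ?thesis
      using \<open>A \<in>\<^sub>V B\<close> by blast
  qed
  then obtain A where "A \<in>\<^sub>V B" and A: "\<And>x i. x \<in>\<^sub>V A \<Longrightarrow> i \<in>\<^sub>V \<eta> \<Longrightarrow> vpair i x \<in>\<^sub>V Q"
    using base_closedE[OF closed[OF \<eta>], of Q] by blast
  moreover have "vpair \<xi> x \<in>\<^sub>V R" if "x \<in>\<^sub>V A" "\<xi> \<in>\<^sub>V \<delta>" for x \<xi>
    using cof[OF that(2)] A[OF that(1)] vapp_vpair_mem[OF fun_h] unfolding Q by blast
  ultimately show "\<exists>A. A \<in>\<^sub>V B \<and> (\<forall>x. x \<in>\<^sub>V A \<longrightarrow> (\<forall>\<xi>. \<xi> \<in>\<^sub>V \<delta> \<longrightarrow> vpair \<xi> x \<in>\<^sub>V R))"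
    by blast
qed

lemma vregular_cardinal_least_not_base_closed:
  assumes B: "vfilter_base X B" and \<delta>: "vordinal \<delta>" and not_closed: "\<not> base_closed B \<delta>"
    and closed: "\<And>\<eta>. \<eta> \<in>\<^sub>V \<delta> \<Longrightarrow> base_closed B \<eta>"
  shows "vregular_cardinal \<delta>"
proof -
  have no_cofinal: "\<not> vcofinal_map h \<eta> \<delta>" if "\<eta> \<in>\<^sub>V \<delta>" for h \<eta>
    using base_closed_cofinal[OF B \<delta> closed that] not_closed by blast
  \<comment> \<open>A bijection onto \<open>\<delta>\<close> is in particular cofinal.\<close>
  have no_bij: "\<not> vbij h \<eta> \<delta>" if "\<eta> \<in>\<^sub>V \<delta>" for h \<eta>
    using no_cofinal[OF that, of h] unfolding vbij_def vcofinal_map_def vord_le_def by blast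
  \<comment> \<open>At the empty ordinal any member of the nonempty base is a witness of
    closure.\<close>
  have "vnonempty \<delta>"
    using not_closed B unfolding base_closed_def vfilter_base_def vnonempty_def by blast
  moreover have "\<not> vsucc_of \<delta> k" for k
  proof
    assume succ: "vsucc_of \<delta> k"
    then have mem: "x \<in>\<^sub>V \<delta> \<longleftrightarrow> x \<in>\<^sub>V k \<or> x = k" for x
      unfolding vsucc_of_def by blast
    then have k: "base_closed B k"
      using closed by blast
    have "base_closed B \<delta>"
      unfolding base_closed_def mem
      by (intro allI impI, rule base_closed_insert[OF B k], blast)
    then show False
      using not_closed by blast
  qed
  ultimately have not_finite: "\<not> vfinite_ordinal \<delta>"
    unfolding vfinite_ordinal_def vord_le_def by blast
  \<comment> \<open>The identity shows that the cofinality of \<open>\<delta>\<close> is at most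
    \<open>\<delta>\<close>.\<close>
  obtain f where "vfun f \<delta> \<delta>" "\<And>\<xi>. \<xi> \<in>\<^sub>V \<delta> \<Longrightarrow> vapp f \<xi> = \<xi>"
  proof (rule definable_function[where P = "\<lambda>x y. y = x" and a = \<delta> and b = \<delta>])
    show "definable (\<lambda>e. e 0 = e (Suc 0))"
      by (intro definable_intros)
  qed blast+
  then have "vcofinal_map f \<delta> \<delta>"
    unfolding vcofinal_map_def vord_le_def by metis
  then show ?thesis
    using \<delta> not_finite no_bij no_cofinal
    unfolding vregular_cardinal_def vinfinite_cardinal_def vis_cofinality_def by blast
qed

section \<open>The regular case and the theorem\<close>

lemma base_closed_regular:
  assumes B: "vfilter_base X B"
    and \<delta>: "vordinal \<delta>" and closed: "\<And>\<eta>. \<eta> \<in>\<^sub>V \<delta> \<Longrightarrow> base_closed B \<eta>"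
    and U: "vfilter (vPow B) U" and fine: "vfine B U"
    and desc: "vdescendingly_closed (vPow B) \<delta> U"
    and conc: "vconcentrates_on U (vcollect (\<lambda>\<sigma>. \<sigma> \<subseteq>\<^sub>V B \<and> vInter X \<sigma> \<in>\<^sub>V B))"
  shows "base_closed B \<delta>"
  unfolding base_closed_def
proof (intro allI impI)
  fix R
  assume R: "\<forall>\<xi>. \<xi> \<in>\<^sub>V \<delta> \<longrightarrow> (\<exists>A. A \<in>\<^sub>V B \<and> (\<forall>x. x \<in>\<^sub>V A \<longrightarrow> vpair \<xi> x \<in>\<^sub>V R))"
  \<comment> \<open>\<open>G i\<close> describes the set \<open>S\<close> at index \<open>i\<close>.
    The intersection of \<open>\<sigma>\<close> is written out, with value \<open>X\<close> for
    empty \<open>\<sigma>\<close>, so that \<open>G\<close> is first-order.\<close>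
  define G where "G i \<sigma> \<longleftrightarrow> \<sigma> \<in>\<^sub>V vPow B \<and>
      (\<forall>x. (x \<in>\<^sub>V X \<and> (\<forall>A. A \<in>\<^sub>V \<sigma> \<longrightarrow> x \<in>\<^sub>V A)) \<longrightarrow>
        (\<forall>\<xi>. \<xi> \<in>\<^sub>V i \<or> \<xi> = i \<longrightarrow> vpair \<xi> x \<in>\<^sub>V R))" for i \<sigma>
  \<comment> \<open>Extensionality makes the member of \<open>U\<close> unique. The whole sequence
    is therefore definable, although the base set \<open>A\<close> used to show membership in
    \<open>U\<close> is not unique.\<close>
  have ex1: "\<exists>!S. S \<in>\<^sub>V U \<and> (\<forall>\<sigma>. \<sigma> \<in>\<^sub>V S \<longleftrightarrow> G i \<sigma>)" if i: "i \<in>\<^sub>V \<delta>" for i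
  proof -
    have "definable (\<lambda>e. G i (e 0))"
      unfolding G_def by (intro definable_intros definable_vpair_mem)
    from definable_separation[OF this, of "vPow B"]
    obtain S where S: "\<And>\<sigma>. \<sigma> \<in>\<^sub>V S \<longleftrightarrow> \<sigma> \<in>\<^sub>V vPow B \<and> G i \<sigma>"
      by blast
    have "\<exists>A. A \<in>\<^sub>V B \<and> (\<forall>x. x \<in>\<^sub>V A \<longrightarrow> (\<forall>\<xi>. \<xi> \<in>\<^sub>V i \<or> \<xi> = i \<longrightarrow> vpair \<xi> x \<in>\<^sub>V R))"
      by (rule base_closed_insert[OF B closed[OF i]]) (use R i vordinal_transitive[OF \<delta> i] in blast)
    then obtain A where A: "A \<in>\<^sub>V B"
      and AR: "\<And>x \<xi>. x \<in>\<^sub>V A \<Longrightarrow> \<xi> \<in>\<^sub>V i \<or> \<xi> = i \<Longrightarrow> vpair \<xi> x \<in>\<^sub>V R"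
      by blast
    define T where "T = vcollect (\<lambda>\<sigma>. \<sigma> \<subseteq>\<^sub>V B \<and> A \<in>\<^sub>V \<sigma>)"
    have T: "\<sigma> \<in>\<^sub>V T \<longleftrightarrow> \<sigma> \<subseteq>\<^sub>V B \<and> A \<in>\<^sub>V \<sigma>" for \<sigma>
      unfolding T_def vsubset_def
      by (rule mem_vcollect_definable[where a = "vPow B"])
        (intro definable_intros, simp add: mem_vPow vsubset_def)
    have "T \<in>\<^sub>V U"
      using fine A unfolding vfine_def T_def by blast
    \<comment> \<open>If \<open>A\<close> is in \<open>\<sigma>\<close>, then the intersection of
      \<open>\<sigma>\<close> lies inside \<open>A\<close>, hence inside the sets of
      \<open>R\<close> with index up to \<open>i\<close>.\<close>
    moreover have "T \<subseteq>\<^sub>V S"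
      unfolding vsubset_def S G_def T mem_vPow using AR by blast
    moreover have "S \<subseteq>\<^sub>V vPow B"
      unfolding vsubset_def using S by blast
    ultimately have "S \<in>\<^sub>V U"
      using U unfolding vfilter_def by blast
    moreover have "\<sigma> \<in>\<^sub>V S \<longleftrightarrow> G i \<sigma>" for \<sigma>
      using S unfolding G_def by blast
    ultimately show ?thesis
      by (metis extensionality)
  qed
  have "definable (\<lambda>e. \<forall>\<sigma>. \<sigma> \<in>\<^sub>V e 0 \<longleftrightarrow> G (e (Suc 0)) \<sigma>)"
    unfolding G_def by (intro definable_intros definable_vpair_mem)
  then obtain f where f: "vfun f \<delta> U"
    and app: "\<And>i. i \<in>\<^sub>V \<delta> \<Longrightarrow> \<forall>\<sigma>. \<sigma> \<in>\<^sub>V vapp f i \<longleftrightarrow> G i \<sigma>"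
    using ex1 by (rule definable_function) blast+
  have "vapp f \<eta> \<subseteq>\<^sub>V vapp f \<xi>" if "\<xi> \<in>\<^sub>V \<delta>" "\<eta> \<in>\<^sub>V \<delta>" "\<xi> \<in>\<^sub>V \<eta>" for \<xi> \<eta>
  proof -
    have "G \<xi> \<sigma>" if "G \<eta> \<sigma>" for \<sigma>
      using that \<open>\<xi> \<in>\<^sub>V \<eta>\<close> vordinal_transitive[OF vordinal_mem[OF \<delta> \<open>\<eta> \<in>\<^sub>V \<delta>\<close>] \<open>\<xi> \<in>\<^sub>V \<eta>\<close>]
      unfolding G_def by blast
    then show ?thesis
      using app[OF that(1)] app[OF that(2)] unfolding vsubset_def by blast
  qed
  then have "vseqInter (vPow B) \<delta> f \<in>\<^sub>V U"
    using desc f unfolding vdescendingly_closed_def by blast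
  moreover define C where "C = vcollect (\<lambda>\<sigma>. \<sigma> \<subseteq>\<^sub>V B \<and> vInter X \<sigma> \<in>\<^sub>V B)"
  then have "C \<in>\<^sub>V U"
    using conc unfolding vconcentrates_on_def by simp
  \<comment> \<open>Both sets belong to \<open>U\<close>, and members of a proper filter
    meet.\<close>
  ultimately have "vnonempty (vseqInter (vPow B) \<delta> f \<inter>\<^sub>V C)"
    using U unfolding vfilter_def by blast
  then obtain \<sigma> where \<sigma>: "\<sigma> \<in>\<^sub>V vseqInter (vPow B) \<delta> f" "\<sigma> \<in>\<^sub>V C"
    unfolding vnonempty_def mem_vint by blast
  \<comment> \<open>First-order form of the concentration condition, which makes \<open>C\<close>
    definable.\<close>
  have Inter_mem: "vInter X \<tau> \<in>\<^sub>V B \<longleftrightarrow>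
      (\<exists>D. D \<in>\<^sub>V B \<and> (\<forall>x. x \<in>\<^sub>V D \<longleftrightarrow> x \<in>\<^sub>V X \<and> (\<forall>A. A \<in>\<^sub>V \<tau> \<longrightarrow> x \<in>\<^sub>V A)))" for \<tau>
    unfolding eq_vInter_iff[symmetric] by blast
  have "\<sigma> \<subseteq>\<^sub>V B \<and> vInter X \<sigma> \<in>\<^sub>V B"
  proof -
    have "\<sigma> \<in>\<^sub>V C \<longleftrightarrow> \<sigma> \<subseteq>\<^sub>V B \<and> vInter X \<sigma> \<in>\<^sub>V B"
      unfolding C_def Inter_mem vsubset_def
      by (rule mem_vcollect_definable[where a = "vPow B"])
        (intro definable_intros, simp add: mem_vPow vsubset_def)
    then show ?thesis
      using \<sigma>(2) by blast
  qed
  moreover have "vpair \<xi> x \<in>\<^sub>V R" if "x \<in>\<^sub>V vInter X \<sigma>" "\<xi> \<in>\<^sub>V \<delta>" for x \<xi>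
    using \<sigma>(1) that app[OF that(2)] unfolding mem_vseqInter[OF f] mem_vInter G_def by blast
  ultimately show "\<exists>A. A \<in>\<^sub>V B \<and> (\<forall>x. x \<in>\<^sub>V A \<longrightarrow> (\<forall>\<xi>. \<xi> \<in>\<^sub>V \<delta> \<longrightarrow> vpair \<xi> x \<in>\<^sub>V R))"
    by blast
qed

section \<open>From the base to the generated filter\<close>

text \<open>Each term of the sequence contains a base set, so closure of the base yields one base
  set inside all of them. It witnesses that the intersection is in the filter.\<close>

lemma vclosed_if_base_closed:
  assumes B: "vfilter_base X B" and closed: "base_closed B \<beta>"
  shows "vclosed X \<beta> (vgenerated_filter X B)"
  unfolding vclosed_def
proof (intro allI impI)
  fix f
  assume f: "vfun f \<beta> (vgenerated_filter X B)"
  \<comment> \<open>\<open>R\<close> codes the sequence \<open>f\<close>: for \<open>\<xi>\<close>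
    in \<open>\<beta>\<close>, its section at \<open>\<xi>\<close> is the set
    \<open>f(\<xi>)\<close>.\<close>
  have "definable (\<lambda>e. \<exists>y. vpair (e (Suc 0)) y \<in>\<^sub>V f \<and> e 0 \<in>\<^sub>V y)"
    by (intro definable_intros definable_vpair_mem)
  then obtain R where R: "\<And>\<xi> x. vpair \<xi> x \<in>\<^sub>V R \<longleftrightarrow>
      \<xi> \<in>\<^sub>V \<beta> \<and> x \<in>\<^sub>V X \<and> (\<exists>y. vpair \<xi> y \<in>\<^sub>V f \<and> x \<in>\<^sub>V y)"
    by (rule definable_relation) blast
  have "\<exists>A. A \<in>\<^sub>V B \<and> (\<forall>x. x \<in>\<^sub>V A \<longrightarrow> vpair \<xi> x \<in>\<^sub>V R)" if "\<xi> \<in>\<^sub>V \<beta>" for \<xi>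
    using vapp_mem[OF f that] vapp_vpair_mem[OF f that] base_mem_subset[OF B] that
    unfolding R mem_vgenerated_filter vsubset_def by blast
  then obtain A where "A \<in>\<^sub>V B" and A: "\<And>x \<xi>. x \<in>\<^sub>V A \<Longrightarrow> \<xi> \<in>\<^sub>V \<beta> \<Longrightarrow> vpair \<xi> x \<in>\<^sub>V R"
    using base_closedE[OF closed, of R] by blast
  have "A \<subseteq>\<^sub>V vseqInter X \<beta> f"
    unfolding vsubset_def mem_vseqInter[OF f]
    using A base_mem_subset[OF B \<open>A \<in>\<^sub>V B\<close>] vapp_eqI[OF f] unfolding R by blast
  then show "vseqInter X \<beta> f \<in>\<^sub>V vgenerated_filter X B"
    using \<open>A \<in>\<^sub>V B\<close> mem_vseqInter[OF f] unfolding mem_vgenerated_filter vsubset_def by blast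
qed

theorem theorem3p1:
  fixes X B \<beta> :: "'v::ZF"
  assumes "vfilter_base X B"
    and "vordinal \<beta>"
    and "\<And>\<gamma>. vregular_cardinal \<gamma> \<Longrightarrow> \<gamma> \<le>\<^sub>V \<beta> \<Longrightarrow>
           \<exists>U. vfilter (vPow B) U \<and> vfine B U \<and> vdescendingly_closed (vPow B) \<gamma> U \<and>
               vconcentrates_on U (vcollect (\<lambda>\<sigma>. \<sigma> \<subseteq>\<^sub>V B \<and> vInter X \<sigma> \<in>\<^sub>V B))"
  shows "vclosed X \<beta> (vgenerated_filter X B)"
proof (rule vclosed_if_base_closed[OF assms(1)], rule ccontr)
  assume "\<not> base_closed B \<beta>"
  then obtain \<delta> where \<delta>: "vordinal \<delta>" "\<delta> \<le>\<^sub>V \<beta>" and not_closed: "\<not> base_closed B \<delta>"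
    and closed: "\<And>\<eta>. \<eta> \<in>\<^sub>V \<delta> \<Longrightarrow> base_closed B \<eta>"
    using least_not_base_closed[OF assms(2)] by metis
  have "vregular_cardinal \<delta>"
    using assms(1) \<delta>(1) not_closed closed by (rule vregular_cardinal_least_not_base_closed)
  then obtain U where "vfilter (vPow B) U" "vfine B U" "vdescendingly_closed (vPow B) \<delta> U"
    "vconcentrates_on U (vcollect (\<lambda>\<sigma>. \<sigma> \<subseteq>\<^sub>V B \<and> vInter X \<sigma> \<in>\<^sub>V B))"
    using assms(3) \<delta>(2) by blast
  with base_closed_regular[OF assms(1) \<delta>(1) closed] not_closed show False
    by blast
qed

end
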